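(* Let $n\ge 3$ and $k\ge 1$ be integers. Let $\mathfrak{C}_n$ be a cyclic group of order $n$, acting on the cycle graph $C_n$ via rotation. Then $\mathfrak{C}_n$ acts on the helm graph $H_n$, and $$\left(\mathcal{I}_k(H_n),\ \mathfrak{C}_n,\ \begin{bmatrix} n\\ k-1\end{bmatrix}+\sum_{j=0}^k \frac{[n]}{[n-j]}\begin{bmatrix} n-j\\ j\end{bmatrix}\begin{bmatrix} n-j\\ k-j\end{bmatrix}\right)$$ exhibits the cyclic sieving phenomenon.
   Context: The cycle graph $C_n$ has vertex set $V=\{0,\ldots,n-1\}$ and edges $i\sim(i+1)\bmod n$; rotation means that a generator of $\mathfrak{C}_n$ acts by $i\mapsto (i+1)\bmod n$. The whiskering $w(C_n)$ has vertex set $V\cup V'$, where $V'=\{v':v\in V\}$ is a disjoint copy of $V$, and its edges are the edges of $C_n$ together with the edges $vv'$ for $v\in V$. The helm graph $H_n$ is obtained from $w(C_n)$ by adding one new vertex $x$ (the central vertex) that is adjacent to all vertices of $V$ and to no vertex of $V'$. The action of $\mathfrak{C}_n$ on $H_n$ is the rotation on $V$, $\mathfrak{g}(v')=(\mathfrak{g}(v))'$ on $V'$, and fixes $x$. $\mathcal{I}_k(G)$ is the collection of independent sets of size $k$ of a graph $G$; a group acting on $G$ by automorphisms acts on $\mathcal{I}_k(G)$ by $\mathfrak{g}S=\{\mathfrak{g}v:v\in S\}$. $[m]=1+q+\cdots+q^{m-1}$, and $\begin{bmatrix} a\\ b\end{bmatrix}$ is the $q$-binomial coefficient, equal to $\frac{[a]!}{[b]!\,[a-b]!}$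 for $0\le b\le a$ (with $[m]!=[1][2]\cdots[m]$) and $0$ otherwise. The factor $\frac{[n]}{[n-j]}\begin{bmatrix} n-j\\ j\end{bmatrix}$ is read as $0$ when $2j>n$; for $2j\le n$ it is a polynomial in $q$. Cyclic sieving phenomenon (CSP): for a finite cyclic group $\mathfrak{C}$, a finite set $X$ and a polynomial $f(q)$, the triple $(X,\mathfrak{C},f(q))$ exhibits the CSP if $\mathfrak{C}$ acts on $X$ and for every $\mathfrak{g}\in\mathfrak{C}$ of order $d$ and every primitive $d$th root of unity $\omega\in\mathbb{C}$ we have $|X^{\mathfrak{g}}|=f(\omega)$, where $X^{\mathfrak{g}}=\{x\in X:\mathfrak{g}x=x\}$. *)

theory Defs
  imports
    "HOL-Algebra.Group_Action"
    "HOL-Algebra.Elementary_Groups"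
    "HOL-Algebra.Multiplicative_Group"
    "HOL-Computational_Algebra.Polynomial"
    "Graph_Theory.Pair_Digraph"
begin

section \<open>Graphs\<close>

text \<open>
  Following the Graph Theory library, an undirected simple graph is a loop-free symmetric
  digraph (\<^locale>\<open>pair_graph\<close>): an edge between u and v is the pair of arcs (u, v) and (v, u).
\<close>

definition cycle_graph :: "nat \<Rightarrow> nat pair_pre_digraph" where
  "cycle_graph n =
     \<lparr> pverts = {0..<n},
       parcs = {(i, j). i < n \<and> j < n \<and> (j = (i + 1) mod n \<or> i = (j + 1) mod n)} \<rparr>"

datatype 'a whisker_vertex = Orig 'a | Copy 'a

definition whiskering :: "'a pair_pre_digraph \<Rightarrow> 'a whisker_vertex pair_pre_digraph" where
  "whiskering G =
     \<lparr> pverts = Orig ` pverts G \<union> Copy ` pverts G,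
       parcs = map_prod Orig Orig ` parcs G
         \<union> {(Orig v, Copy v) | v. v \<in> pverts G}
         \<union> {(Copy v, Orig v) | v. v \<in> pverts G} \<rparr>"

text \<open>
  In the helm graph, \<^const>\<open>Some\<close> embeds the vertices of the whiskered cycle and
  \<^const>\<open>None\<close> is the central vertex.
\<close>

definition helm_graph :: "nat \<Rightarrow> nat whisker_vertex option pair_pre_digraph" where
  "helm_graph n =
     \<lparr> pverts = insert None (Some ` pverts (whiskering (cycle_graph n))),
       parcs = map_prod Some Some ` parcs (whiskering (cycle_graph n))
         \<union> {(None, Some (Orig v)) | v. v \<in> pverts (cycle_graph n)}
         \<union> {(Some (Orig v), None) | v. v \<in> pverts (cycle_graph n)} \<rparr>"

lemma pair_graph_cycle_graph:
  assumes "n \<ge> 3"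
  shows "pair_graph (cycle_graph n)"
proof -
  have "(i + 1) mod n \<noteq> i" if "i < n" for i
    using that assms by (cases "i + 1 = n") auto
  moreover have "finite {(i, j). i < n \<and> j < n \<and> (j = (i + 1) mod n \<or> i = (j + 1) mod n)}"
    by (rule finite_subset[of _ "{0..<n} \<times> {0..<n}"]) auto
  ultimately show ?thesis
    by unfold_locales
      (auto simp: cycle_graph_def arcs_ends_def arc_to_ends_def symmetric_def sym_def, metis)
qed

definition indep_sets :: "nat \<Rightarrow> 'a pair_pre_digraph \<Rightarrow> 'a set set" where
  "indep_sets k G =
     {S. S \<subseteq> pverts G \<and> finite S \<and> card S = k \<and> (\<forall>u\<in>S. \<forall>v\<in>S. (u, v) \<notin> parcs G)}"

lemma pair_graph_helm_graph:
  assumes "n \<ge> 3"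
  shows "pair_graph (helm_graph n)"
proof -
  interpret pair_graph "cycle_graph n"
    using pair_graph_cycle_graph[OF assms] .
  have *: "(u, v) \<in> parcs (cycle_graph n) \<Longrightarrow> (v, u) \<in> parcs (cycle_graph n)" for u v
    by (auto simp: cycle_graph_def)
  have fin: "finite {(f v, g v) | v. v \<in> pverts (cycle_graph n)}" for f g :: "nat \<Rightarrow> 'b"
    by simp
  have "symmetric (with_proj (helm_graph n))"
  proof -
    have "(b, a) \<in> parcs (helm_graph n)" if "(a, b) \<in> parcs (helm_graph n)" for a b
    proof -
      have "map_prod Orig Orig (u, v) \<in> map_prod Orig Orig ` parcs (cycle_graph n)"
        if "(v, u) \<in> parcs (cycle_graph n)" for u v
        using *[OF that] by (rule imageI)
      then have "(q, p) \<in> parcs (whiskering (cycle_graph n))"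
        if "(p, q) \<in> parcs (whiskering (cycle_graph n))" for p q
        using that unfolding whiskering_def by auto
      then have "map_prod Some Some (q, p) \<in> map_prod Some Some ` parcs (whiskering (cycle_graph n))"
        if "(p, q) \<in> parcs (whiskering (cycle_graph n))" for p q
        using that by (intro imageI)
      then show ?thesis
        using that unfolding helm_graph_def by auto
    qed
    then show ?thesis
      by (auto simp: symmetric_def sym_def arcs_ends_def arc_to_ends_def)
  qed
  then show ?thesis
    by unfold_locales
      (auto simp: helm_graph_def whiskering_def fin dest: in_arcsD1 in_arcsD2 pair_no_loops)
qed

section \<open>Group actions on graphs\<close>

definition graph_action ::
    "('g, 'm) monoid_scheme \<Rightarrow> 'a pair_pre_digraph \<Rightarrow> ('g \<Rightarrow> 'a \<Rightarrow> 'a) \<Rightarrow> bool" where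
  "graph_action C G \<phi> \<longleftrightarrow>
     group_action C (pverts G) \<phi> \<and>
     (\<forall>g\<in>carrier C. \<forall>u\<in>pverts G. \<forall>v\<in>pverts G.
        (\<phi> g u, \<phi> g v) \<in> parcs G \<longleftrightarrow> (u, v) \<in> parcs G)"

definition rotation_action ::
    "('g, 'm) monoid_scheme \<Rightarrow> nat \<Rightarrow> ('g \<Rightarrow> nat \<Rightarrow> nat) \<Rightarrow> bool" where
  "rotation_action C n \<phi> \<longleftrightarrow>
     graph_action C (cycle_graph n) \<phi> \<and>
     (\<exists>c\<in>carrier C. subgroup_generated C {c} = C \<and> (\<forall>i<n. \<phi> c i = (i + 1) mod n))"

text \<open>
  The locale \<^locale>\<open>group_action\<close> takes its maps from \<^const>\<open>BijGroup\<close>, hence they have to be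
  \<^const>\<open>undefined\<close> outside the set acted upon; this is why both induced actions are restricted.
\<close>

definition helm_action ::
    "nat \<Rightarrow> ('g \<Rightarrow> nat \<Rightarrow> nat) \<Rightarrow> 'g \<Rightarrow> nat whisker_vertex option \<Rightarrow> nat whisker_vertex option" where
  "helm_action n \<phi> g =
     restrict (map_option (map_whisker_vertex (\<phi> g))) (pverts (helm_graph n))"

definition set_action :: "'a set set \<Rightarrow> ('g \<Rightarrow> 'a \<Rightarrow> 'a) \<Rightarrow> 'g \<Rightarrow> 'a set \<Rightarrow> 'a set" where
  "set_action X \<phi> g = (\<lambda>S\<in>X. \<phi> g ` S)"

section \<open>q-analogues\<close>

definition q_int :: "nat \<Rightarrow> complex poly" where
  "q_int m = (\<Sum>i<m. monom 1 i)"

definition q_fact :: "nat \<Rightarrow> complex poly" where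
  "q_fact m = (\<Prod>i=1..m. q_int i)"

definition q_binomial :: "nat \<Rightarrow> nat \<Rightarrow> complex poly" where
  "q_binomial a b = (if b \<le> a then q_fact a div (q_fact b * q_fact (a - b)) else 0)"

text \<open>The factor [n] / [n - j] * q_binomial (n - j) j, read as 0 when 2 j > n.\<close>

definition q_cycle_factor :: "nat \<Rightarrow> nat \<Rightarrow> complex poly" where
  "q_cycle_factor n j =
     (if 2 * j \<le> n then (q_int n * q_binomial (n - j) j) div q_int (n - j) else 0)"

text \<open>Both polynomial divisions are exact, so they agree with the quotients of rational functions.\<close>

lemma q_int_neq_0: "m > 0 \<Longrightarrow> q_int m \<noteq> 0"
proof -
  assume "m > 0"
  then have "coeff (q_int m) 0 = 1"
    by (simp add: q_int_def coeff_sum coeff_monom)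
  then show ?thesis by auto
qed

lemma q_fact_neq_0: "q_fact m \<noteq> 0"
  by (auto simp: q_fact_def q_int_neq_0)

lemma q_int_add: "q_int (a + b) = q_int a + monom 1 a * q_int b"
  by (induction b) (simp_all add: q_int_def algebra_simps mult_monom)

lemma q_fact_Suc: "q_fact (Suc m) = q_int (Suc m) * q_fact m"
  by (simp add: q_fact_def mult.commute)

lemma q_fact_dvd: "q_fact b * q_fact c dvd q_fact (b + c)"
proof (induction "b + c" arbitrary: b c)
  case 0
  then show ?case by (auto simp: q_fact_def)
next
  case (Suc m)
  show ?case
  proof (cases "b = 0 \<or> c = 0")
    case True
    then show ?thesis by (auto simp: q_fact_def)
  next
    case False
    then obtain b' c' where bc: "b = Suc b'" "c = Suc c'"
      by (meson not0_implies_Suc)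
    have "q_fact b * q_fact c' dvd q_fact (b + c')" "q_fact b' * q_fact c dvd q_fact (b' + c)"
      using Suc(1)[of b c'] Suc(1)[of b' c] Suc(2) by (simp_all add: bc)
    then have "q_fact b * q_fact c dvd q_int c * q_fact m" "q_fact b * q_fact c dvd q_int b * q_fact m"
      using Suc(2) by (simp_all add: bc q_fact_Suc mult_ac mult_dvd_mono)
    then have "q_fact b * q_fact c dvd q_int b * q_fact m + monom 1 b * (q_int c * q_fact m)"
      by (meson dvd_add dvd_mult)
    also have "\<dots> = q_int (b + c) * q_fact m"
      by (simp add: q_int_add algebra_simps)
    also have "\<dots> = q_fact (Suc m)"
      by (simp add: q_fact_Suc Suc(2)[symmetric])
    finally show ?thesis using Suc(2) by simp
  qed
qed

lemma q_binomial_mult: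
  assumes "b \<le> a"
  shows "q_binomial a b * (q_fact b * q_fact (a - b)) = q_fact a"
  using assms q_fact_dvd[of b "a - b"] by (simp add: q_binomial_def)

lemma q_cycle_factor_mult:
  assumes "2 * j \<le> n" "n > 0"
  shows "q_cycle_factor n j * q_int (n - j) = q_int n * q_binomial (n - j) j"
proof (cases j)
  case 0
  then show ?thesis using assms by (simp add: q_cycle_factor_def)
next
  case (Suc i)
  define m where "m = n - j - 1"
  have m: "n - j = Suc m" "i \<le> m"
    using assms Suc by (auto simp: m_def)
  have "q_int j * q_binomial (n - j) j * (q_fact i * q_fact (m - i)) = q_int (n - j) * q_fact m"
    using q_binomial_mult[of "Suc i" "Suc m"] m(2)
    by (simp add: m(1) Suc m(1)[unfolded Suc] q_fact_Suc mult_ac)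
  also have "\<dots> = q_int (n - j) * q_binomial m i * (q_fact i * q_fact (m - i))"
    using q_binomial_mult[OF m(2)] by (simp add: mult_ac)
  finally have "q_int j * q_binomial (n - j) j = q_int (n - j) * q_binomial m i"
    using q_fact_neq_0 by simp
  moreover have "q_int n = q_int (n - j) + monom 1 (n - j) * q_int j"
    using q_int_add[of "n - j" j] assms by simp
  ultimately have "q_int n * q_binomial (n - j) j =
      q_int (n - j) * (q_binomial (n - j) j + monom 1 (n - j) * q_binomial m i)"
    by (simp add: algebra_simps)
  then show ?thesis
    using assms by (simp add: q_cycle_factor_def)
qed

section \<open>Cyclic sieving\<close>

definition primitive_root_of_unity :: "nat \<Rightarrow> complex \<Rightarrow> bool" where
  "primitive_root_of_unity d \<omega> \<longleftrightarrow> d > 0 \<and> \<omega> ^ d = 1 \<and> (\<forall>m. 0 < m \<and> m < d \<longrightarrow> \<omega> ^ m \<noteq> 1)"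

definition exhibits_CSP ::
    "'x set \<Rightarrow> ('g, 'm) monoid_scheme \<Rightarrow> ('g \<Rightarrow> 'x \<Rightarrow> 'x) \<Rightarrow> complex poly \<Rightarrow> bool" where
  "exhibits_CSP X C \<phi> f \<longleftrightarrow>
     group C \<and> cyclic_group C \<and> finite (carrier C) \<and> finite X \<and> group_action C X \<phi> \<and>
     (\<forall>g\<in>carrier C. \<forall>\<omega>. primitive_root_of_unity (group.ord C g) \<omega> \<longrightarrow>
        of_nat (card (invariants X \<phi> g)) = poly f \<omega>)"

end

theory Submission
  imports Defs "HOL-Number_Theory.Cong"
begin

text \<open>
  An element of the group rotates the n-cycle by some m. With e = gcd m n its order is d = n / e,
  and a set of vertices is invariant under it if and only if it has period e
  (\<open>rotation_fixed_iff_periodic\<close>). Hence the invariant sets correspond to sets of residues modulo e,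
  with sizes divided by d, and adjacency in the n-cycle becomes adjacency in the e-cycle, where the
  1-cycle is a loop. An independent set of the helm graph that contains the centre consists
  otherwise of whisker ends only; one that does not contain it is given by an independent set A of
  the cycle and a set B of whisker ends outside of A. So there are two kinds of invariant
  independent k-sets (\<open>card_invariants_indep_sets_helm\<close>): the sets B of residues with
  d |B| = k - 1, and the pairs of an independent set A of the e-cycle and a set B disjoint from A
  with d (|A| + |B|) = k.

  Both kinds are counted by values of q-analogues at a primitive d-th root of unity \<open>\<omega>\<close>. The
  q-binomial coefficient of d a over b has the value a choose b / d if d divides b, and 0 otherwise:
  for d > 1, the factors of a q-factorial that vanish at \<open>\<omega>\<close> are the [d i], and in all
  cases [d i] / [d] takes the value i there. So it counts the b / d-subsets of an a-set. In the same
  way, for j = d i with 2 i \<le> e, the factor [n] / [n - j] times the q-binomial coefficient of n - j over j takes the value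
  e / (e - i) times (e - i choose i). This is the number of independent i-sets of the e-cycle,
  by double counting of the pairs of such a set and a vertex outside of it (\<open>card_cycle_indep\<close>).
  If d does not divide j, the value is 0, because [n] vanishes at \<open>\<omega>\<close> and [n - j] does not. Summing
  over j = d |A| gives the number of pairs, since B is chosen among e - |A| residues, whatever A is
  (\<open>card_cycle_indep_pairs\<close>).
\<close>

section \<open>The q-analogues at a root of unity\<close>

lemma primitive_root_power_eq_1_iff:
  assumes "primitive_root_of_unity d \<omega>"
  shows "\<omega> ^ m = 1 \<longleftrightarrow> d dvd m"
proof -
  have d: "d > 0" "\<omega> ^ d = 1" "\<And>m. 0 < m \<Longrightarrow> m < d \<Longrightarrow> \<omega> ^ m \<noteq> 1"
    using assms by (auto simp: primitive_root_of_unity_def)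
  have "\<omega> ^ m = \<omega> ^ (d * (m div d) + m mod d)"
    by simp
  also have "\<dots> = \<omega> ^ (m mod d)"
    by (simp only: power_add power_mult d(2) power_one mult_1)
  finally show ?thesis
    using d(1) d(3)[of "m mod d"] by (auto simp: dvd_eq_mod_eq_0)
qed

lemma poly_q_int_geometric: "(x - 1) * poly (q_int m) x = x ^ m - 1"
  by (induction m) (simp_all add: q_int_def poly_sum poly_monom algebra_simps)

lemma poly_q_int_eq_0_iff:
  assumes "primitive_root_of_unity d \<omega>" "d \<noteq> 1"
  shows "poly (q_int m) \<omega> = 0 \<longleftrightarrow> d dvd m"
proof -
  have "\<omega> \<noteq> 1"
    using primitive_root_power_eq_1_iff[OF assms(1), of 1] assms(2) by simp
  then show ?thesis
    using poly_q_int_geometric[of \<omega> m] primitive_root_power_eq_1_iff[OF assms(1), of m]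
    by (metis eq_iff_diff_eq_0 mult_eq_0_iff)
qed

lemma poly_q_int_neq_0:
  assumes "primitive_root_of_unity d \<omega>" "\<not> d dvd m"
  shows "poly (q_int m) \<omega> \<noteq> 0"
  using poly_q_int_eq_0_iff[of d \<omega> m] assms by auto

text \<open>The quotient [d * a] / [d], that is, the polynomial [a] in the variable q ^ d.\<close>

definition q_int_quot :: "nat \<Rightarrow> nat \<Rightarrow> complex poly" where
  "q_int_quot d a = (\<Sum>r<a. monom 1 (d * r))"

lemma q_int_mult: "q_int (d * a) = q_int d * q_int_quot d a"
proof (induction a)
  case (Suc a)
  have "q_int (d * Suc a) = q_int (d * a) + monom 1 (d * a) * q_int d"
    using q_int_add[of "d * a" d] by (simp add: add.commute)
  also have "\<dots> = q_int d * q_int_quot d (Suc a)"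
    unfolding Suc by (simp add: q_int_quot_def algebra_simps)
  finally show ?case .
qed (simp add: q_int_def q_int_quot_def)

lemma poly_q_int_quot:
  assumes "primitive_root_of_unity d \<omega>"
  shows "poly (q_int_quot d a) \<omega> = of_nat a"
  using assms
  by (simp add: q_int_quot_def poly_sum poly_monom power_mult primitive_root_of_unity_def)

text \<open>
  For d > 1, exactly the a factors [d * i] of [d * a]! vanish at a primitive d-th root of unity, and
  each of them to the order of [d]. After division of these factors by [d], every full period of
  d factors contributes the value i of [d * i] / [d] and one and the same nonzero product of the
  values of [1], ..., [d - 1].
\<close>

lemma q_fact_mult_factorization:
  assumes "primitive_root_of_unity d \<omega>"
  obtains P u where "\<And>a. q_fact (d * a) = q_int d ^ a * P a"
    and "\<And>a. poly (P a) \<omega> = fact a * u ^ a" and "u \<noteq> (0 :: complex)"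
proof -
  have d: "d > 0"
    using assms by (simp add: primitive_root_of_unity_def)
  define R where "R a = (\<Prod>i=1..<d. q_int (d * a + i))" for a
  define P where "P a = (\<Prod>b<a. R b * q_int_quot d (Suc b))" for a
  define u where "u = (\<Prod>i=1..<d. poly (q_int i) \<omega>)"
  have fact_add: "q_fact (m + l) = q_fact m * (\<Prod>i=1..l. q_int (m + i))" for m l
    by (induction l) (simp_all add: q_fact_Suc mult_ac)
  have step: "q_fact (d * Suc a) = q_fact (d * a) * (R a * q_int (d * Suc a))" for a
  proof -
    have "{1..d} = insert d {1..<d}"
      using d by auto
    then have "(\<Prod>i=1..d. q_int (d * a + i)) = R a * q_int (d * a + d)"
      by (simp add: R_def mult.commute)
    then show ?thesis
      using fact_add[of "d * a" d] by (simp add: algebra_simps)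
  qed
  have 1: "q_fact (d * a) = q_int d ^ a * P a" for a
  proof (induction a)
    case 0
    then show ?case by (simp add: P_def q_fact_def)
  next
    case (Suc a)
    show ?case
      unfolding step Suc q_int_mult by (simp add: P_def mult_ac)
  qed
  have R: "poly (R a) \<omega> = u" for a
    unfolding R_def u_def poly_prod
  proof (rule prod.cong)
    fix i assume "i \<in> {1..<d}"
    then have "poly (q_int (d * a)) \<omega> = 0" "\<omega> ^ (d * a) = 1"
      using poly_q_int_eq_0_iff[OF assms, of "d * a"] primitive_root_power_eq_1_iff[OF assms]
      by auto
    then show "poly (q_int (d * a + i)) \<omega> = poly (q_int i) \<omega>"
      by (simp add: q_int_add poly_monom)
  qed simp
  have 2: "poly (P a) \<omega> = fact a * u ^ a" for a
    by (induction a) (simp_all add: P_def R poly_q_int_quot[OF assms] mult_ac)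
  have "poly (q_int i) \<omega> \<noteq> 0" if "i \<in> {1..<d}" for i
    using that by (intro poly_q_int_neq_0[OF assms]) (auto dest: dvd_imp_le)
  then have "u \<noteq> 0"
    by (simp add: u_def)
  then show thesis
    using that 1 2 by blast
qed

lemma poly_q_binomial_dvd:
  assumes "primitive_root_of_unity d \<omega>"
  shows "poly (q_binomial (d * a) (d * b)) \<omega> = of_nat (a choose b)"
proof (cases "b \<le> a")
  case True
  obtain P u where P: "\<And>a. q_fact (d * a) = q_int d ^ a * P a"
    "\<And>a. poly (P a) \<omega> = fact a * u ^ a" and u: "u \<noteq> (0 :: complex)"
    using q_fact_mult_factorization[OF assms] by blast
  have nz: "q_int d \<noteq> 0"
    using assms by (simp add: q_int_neq_0 primitive_root_of_unity_def)
  have ab: "q_int d ^ b * q_int d ^ (a - b) = q_int d ^ a" "u ^ b * u ^ (a - b) = u ^ a"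
    using True by (simp_all flip: power_add)
  have "q_binomial (d * a) (d * b) * (q_fact (d * b) * q_fact (d * (a - b))) = q_fact (d * a)"
    using q_binomial_mult[of "d * b" "d * a"] True by (simp add: diff_mult_distrib2)
  then have "(q_int d ^ b * q_int d ^ (a - b)) * (q_binomial (d * a) (d * b) * (P b * P (a - b)))
      = q_int d ^ a * P a"
    unfolding P(1) by (simp only: mult_ac)
  then have "q_binomial (d * a) (d * b) * (P b * P (a - b)) = P a"
    using nz by (simp add: ab)
  then have "poly (q_binomial (d * a) (d * b)) \<omega> * (poly (P b) \<omega> * poly (P (a - b)) \<omega>)
      = poly (P a) \<omega>"
    by (metis poly_mult)
  then have "(u ^ b * u ^ (a - b)) *
      (poly (q_binomial (d * a) (d * b)) \<omega> * (fact b * fact (a - b))) = u ^ a * fact a"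
    by (simp add: P mult_ac)
  then have "poly (q_binomial (d * a) (d * b)) \<omega> * (fact b * fact (a - b)) = fact a"
    using u by (simp add: ab)
  then show ?thesis
    unfolding binomial_fact[OF True] by (simp add: eq_divide_eq)
next
  case False
  moreover have "d > 0"
    using assms by (simp add: primitive_root_of_unity_def)
  ultimately show ?thesis
    by (simp add: q_binomial_def binomial_eq_0)
qed

lemma q_binomial_absorption:
  assumes "b > 0" "b \<le> a"
  shows "q_int b * q_binomial a b = q_int a * q_binomial (a - 1) (b - 1)"
proof -
  obtain a' b' where ab: "a = Suc a'" "b = Suc b'" "b' \<le> a'"
    using assms by (metis Suc_le_D Suc_le_mono gr0_implies_Suc)
  have "q_int b * q_binomial a b * (q_fact b' * q_fact (a' - b')) = q_fact a"
    using q_binomial_mult[OF assms(2)] by (simp add: ab q_fact_Suc mult_ac)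
  also have "\<dots> = q_int a * q_binomial a' b' * (q_fact b' * q_fact (a' - b'))"
    using q_binomial_mult[OF ab(3)] by (simp add: ab q_fact_Suc mult_ac)
  finally show ?thesis
    using q_fact_neq_0 by (simp add: ab)
qed

text \<open>
  In the absorption identity [b] * q_binomial (d * a) b = [d * a] * q_binomial (d * a - 1) (b - 1)
  the factor [d * a] vanishes at a primitive d-th root of unity, while [b] does not.
\<close>

lemma poly_q_binomial_not_dvd:
  assumes "primitive_root_of_unity d \<omega>" "\<not> d dvd b"
  shows "poly (q_binomial (d * a) b) \<omega> = 0"
proof (cases "b \<le> d * a")
  case True
  moreover have "b > 0" "d \<noteq> 1"
    using assms(2) by (auto intro: Nat.gr0I)
  ultimately have "poly (q_int b) \<omega> * poly (q_binomial (d * a) b) \<omega> = 0"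
    using q_binomial_absorption[of b "d * a"] poly_q_int_eq_0_iff[OF assms(1), of "d * a"]
    by (metis dvd_triv_left mult_zero_left poly_mult)
  then show ?thesis
    using poly_q_int_neq_0[OF assms] by simp
qed (simp add: q_binomial_def)

text \<open>
  The number [n - j] by which the factor is divided may vanish at the root of unity. If d divides
  both n and j, then [n] and [n - j] are multiples of [d], which cancels and leaves e and e - i.
  If d divides n but not j, then [n] vanishes and [n - j] does not.
\<close>

lemma poly_q_cycle_factor_dvd:
  assumes "primitive_root_of_unity d \<omega>" "e > 0" "2 * i \<le> e"
  shows "of_nat (e - i) * poly (q_cycle_factor (d * e) (d * i)) \<omega> = of_nat (e * ((e - i) choose i))"
proof -
  have d: "d > 0"
    using assms(1) by (simp add: primitive_root_of_unity_def)
  have "q_cycle_factor (d * e) (d * i) * q_int (d * (e - i))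
      = q_int (d * e) * q_binomial (d * (e - i)) (d * i)"
    using q_cycle_factor_mult[of "d * i" "d * e"] assms(2,3) d
    by (simp add: diff_mult_distrib2)
  then have "q_int d * (q_int_quot d (e - i) * q_cycle_factor (d * e) (d * i))
      = q_int d * (q_int_quot d e * q_binomial (d * (e - i)) (d * i))"
    by (simp add: q_int_mult mult_ac)
  then have "q_int_quot d (e - i) * q_cycle_factor (d * e) (d * i)
      = q_int_quot d e * q_binomial (d * (e - i)) (d * i)"
    using q_int_neq_0[OF d] by simp
  then have "poly (q_int_quot d (e - i)) \<omega> * poly (q_cycle_factor (d * e) (d * i)) \<omega>
      = poly (q_int_quot d e) \<omega> * poly (q_binomial (d * (e - i)) (d * i)) \<omega>"
    by (metis poly_mult)
  then show ?thesis
    by (simp add: poly_q_int_quot[OF assms(1)] poly_q_binomial_dvd[OF assms(1)])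
qed

lemma poly_q_cycle_factor_not_dvd:
  assumes "primitive_root_of_unity d \<omega>" "e > 0" "\<not> d dvd j"
  shows "poly (q_cycle_factor (d * e) j) \<omega> = 0"
proof (cases "2 * j \<le> d * e")
  case True
  have "d > 0" "d \<noteq> 1"
    using assms by (auto simp: primitive_root_of_unity_def)
  then have "poly (q_cycle_factor (d * e) j) \<omega> * poly (q_int (d * e - j)) \<omega> = 0"
    using q_cycle_factor_mult[OF True] poly_q_int_eq_0_iff[OF assms(1), of "d * e"] assms(2)
    by (metis dvd_triv_left mult_zero_left nat_0_less_mult_iff poly_mult)
  moreover have "\<not> d dvd d * e - j"
    using True assms(3) dvd_diffD1[of d "d * e" j] by auto
  ultimately show ?thesis
    using poly_q_int_neq_0[OF assms(1)] by simp
qed (simp add: q_cycle_factor_def)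

section \<open>Independent sets of a cycle\<close>

definition path_indep :: "nat \<Rightarrow> nat \<Rightarrow> nat set set" where
  "path_indep m i = {T. T \<subseteq> {0..<m} \<and> card T = i \<and> (\<forall>t\<in>T. Suc t \<notin> T)}"

text \<open>
  The cycle may have length 1 or 2 here, since these lengths occur as quotients of the cycle graph
  by a rotation. A cycle of length 1 is a loop, so that its vertex is in no independent set.
\<close>

definition cycle_indep :: "nat \<Rightarrow> nat set set" where
  "cycle_indep e = {T. T \<subseteq> {0..<e} \<and> (\<forall>t\<in>T. (t + 1) mod e \<notin> T)}"

lemma finite_path_indep: "finite (path_indep m i)"
  by (rule finite_subset[of _ "Pow {0..<m}"]) (auto simp: path_indep_def)

lemma finite_cycle_indep: "finite (cycle_indep e)"
  by (rule finite_subset[of _ "Pow {0..<e}"]) (auto simp: cycle_indep_def)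

lemma path_indep_0: "path_indep m 0 = {{}}"
  by (auto simp: path_indep_def dest: finite_subset)

text \<open>If the last vertex of a path is chosen, then the one before it is not.\<close>

lemma path_indep_Suc_Suc:
  "path_indep (Suc (Suc m)) (Suc i) = path_indep (Suc m) (Suc i) \<union> insert (Suc m) ` path_indep m i"
proof (intro equalityI subsetI)
  fix T assume T: "T \<in> path_indep (Suc (Suc m)) (Suc i)"
  then have fin: "finite T"
    by (auto simp: path_indep_def dest: finite_subset)
  show "T \<in> path_indep (Suc m) (Suc i) \<union> insert (Suc m) ` path_indep m i"
  proof (cases "Suc m \<in> T")
    case True
    then have "m \<notin> T"
      using T by (auto simp: path_indep_def)
    then have "t < m" if "t \<in> T - {Suc m}" for t
      using that T by (auto simp: path_indep_def) (metis atLeastLessThan_iff less_SucE subsetD)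
    then have "T - {Suc m} \<subseteq> {0..<m}"
      by (meson atLeastLessThan_iff le0 subsetI)
    then have "T - {Suc m} \<in> path_indep m i"
      using T fin True by (simp add: path_indep_def)
    moreover have "T = insert (Suc m) (T - {Suc m})"
      using True by auto
    ultimately show ?thesis
      by blast
  next
    case False
    then have "t < Suc m" if "t \<in> T" for t
      using that T by (auto simp: path_indep_def) (metis atLeastLessThan_iff less_SucE subsetD)
    then show ?thesis
      using T by (auto simp: path_indep_def)
  qed
next
  fix T assume "T \<in> path_indep (Suc m) (Suc i) \<union> insert (Suc m) ` path_indep m i"
  then show "T \<in> path_indep (Suc (Suc m)) (Suc i)"
  proof
    assume "T \<in> path_indep (Suc m) (Suc i)"
    then show ?thesis
      by (force simp: path_indep_def)
  next
    assume "T \<in> insert (Suc m) ` path_indep m i"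
    then obtain U where U: "T = insert (Suc m) U" "U \<subseteq> {0..<m}" "card U = i" "\<forall>t\<in>U. Suc t \<notin> U"
      by (auto simp: path_indep_def)
    then have "finite U" "Suc m \<notin> U" "m \<notin> U" "Suc (Suc m) \<notin> U"
      by (auto dest: finite_subset)
    then show ?thesis
      using U by (auto simp: path_indep_def)
  qed
qed

text \<open>
  By the splitting above, the numbers satisfy the recursion of Pascal's triangle. For i > m + 1 the
  truncated difference makes the right-hand side 0 choose i, which is 0 like the left-hand side.
\<close>

lemma card_path_indep: "card (path_indep m i) = (m + 1 - i) choose i"
proof (induction m arbitrary: i rule: less_induct)
  case (less m)
  show ?case
  proof (cases i)
    case 0
    then show ?thesis by (simp add: path_indep_0)
  next
    case i: (Suc i')
    consider "m = 0" | "m = 1" | m' where "m = Suc (Suc m')"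
      by (metis One_nat_def not0_implies_Suc)
    then show ?thesis
    proof cases
      case 1
      then have "path_indep m i = {}"
        by (auto simp: i path_indep_def)
      then show ?thesis
        by (simp add: 1 i)
    next
      case 2
      have "T \<subseteq> {0} \<and> card T = Suc i' \<longleftrightarrow> T = {0} \<and> i' = 0" for T :: "nat set"
        by (cases "T = {}") (auto simp: subset_singleton_iff)
      then have "path_indep 1 (Suc i') = (if i' = 0 then {{0}} else {})"
        by (auto simp: path_indep_def)
      then show ?thesis
        by (simp add: 2 i)
    next
      case (3 m')
      have "inj_on (insert (Suc m')) (path_indep m' i')"
      proof (rule inj_onI)
        fix T U
        assume TU: "T \<in> path_indep m' i'" "U \<in> path_indep m' i'" "insert (Suc m') T = insert (Suc m') U"
        then have "Suc m' \<notin> T" "Suc m' \<notin> U"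
          by (auto simp: path_indep_def)
        then show "T = U"
          using TU(3) by (simp add: insert_ident)
      qed
      moreover have "path_indep (Suc m') (Suc i') \<inter> insert (Suc m') ` path_indep m' i' = {}"
        by (auto simp: path_indep_def)
      ultimately have "card (path_indep m i) = card (path_indep (Suc m') (Suc i')) + card (path_indep m' i')"
        by (simp add: 3 i path_indep_Suc_Suc card_Un_disjoint finite_path_indep card_image)
      also have "\<dots> = ((m' + 1 - i') choose Suc i') + ((m' + 1 - i') choose i')"
        using less[of "Suc m'" "Suc i'"] less[of m' i'] 3 by simp
      also have "\<dots> = (m + 1 - i) choose i"
      proof (cases "i' \<le> m' + 1")
        case True
        then show ?thesis
          by (simp add: 3 i Suc_diff_le)
      qed (simp add: 3 i binomial_eq_0)
      finally show ?thesis .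
    qed
  qed
qed

text \<open>
  The rotation carries the independent sets missing v to those missing the next vertex, so that
  their number is the same for all v. For the last vertex of the cycle, they are the independent
  sets of a path on the other e - 1 vertices.
\<close>

lemma card_cycle_indep_missing:
  assumes "v < e"
  shows "card {T \<in> cycle_indep e. card T = i \<and> v \<notin> T} = (e - i) choose i"
proof -
  define M where "M v = {T \<in> cycle_indep e. card T = i \<and> v \<notin> T}" for v
  define r where "r t = (t + 1) mod e" for t
  have e: "e > 0"
    using assms by simp
  have inj: "inj_on r {0..<e}"
    by (rule inj_onI) (auto simp: r_def mod_Suc split: if_splits)
  have rlt: "r t < e" for t
    using e by (simp add: r_def)
  have le: "card (M w) \<le> card (M (r w))" if w: "w < e" for w
  proof (rule card_inj_on_le)
    show "inj_on ((`) r) (M w)"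
      using inj_on_image_Pow[OF inj] by (rule inj_on_subset) (auto simp: M_def cycle_indep_def)
    show "finite (M (r w))"
      using finite_cycle_indep by (simp add: M_def)
    show "(`) r ` M w \<subseteq> M (r w)"
    proof clarify
      fix T assume T: "T \<in> M w"
      then have sub: "T \<subseteq> {0..<e}" "\<And>t. t \<in> T \<Longrightarrow> r t \<notin> T" "w \<notin> T" "card T = i"
        by (auto simp: M_def cycle_indep_def r_def)
      have mem: "r t \<in> r ` T \<longleftrightarrow> t \<in> T" if "t < e" for t
        using inj_on_image_mem_iff[OF inj, of t T] sub(1) that by simp
      have "card (r ` T) = i"
        using card_image[OF inj_on_subset[OF inj sub(1)]] sub(4) by simp
      moreover have "r w \<notin> r ` T"
        using mem[OF w] sub(3) by simp
      moreover have "r s \<notin> r ` T" if "s \<in> r ` T" for s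
        using that sub(2) mem rlt by auto
      ultimately show "r ` T \<in> M (r w)"
        using rlt by (auto simp: M_def cycle_indep_def r_def)
    qed
  qed
  have up: "card (M w) \<le> card (M (w + l))" if "w + l < e" for w l
    using that
  proof (induction l)
    case (Suc l)
    then have "r (w + l) = w + Suc l"
      by (simp add: r_def)
    then show ?case
      using Suc le[of "w + l"] by simp
  qed simp
  have "card (M v) = card (M (e - 1))"
  proof (rule antisym)
    show "card (M v) \<le> card (M (e - 1))"
      using up[of v "e - 1 - v"] assms by simp
    have "card (M (e - 1)) \<le> card (M 0)"
      using le[of "e - 1"] e by (simp add: r_def)
    then show "card (M (e - 1)) \<le> card (M v)"
      using up[of 0 v] assms by simp
  qed
  also have "M (e - 1) = path_indep (e - 1) i"
  proof -
    have "T \<subseteq> {0..<e} \<and> e - 1 \<notin> T \<longleftrightarrow> T \<subseteq> {0..<e - 1}" for T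
      using e by (auto simp: subset_iff) (metis One_nat_def Suc_pred less_SucE)
    moreover have "(t + 1) mod e = Suc t" if "T \<subseteq> {0..<e - 1}" "t \<in> T" for t T
    proof -
      have "t < e - 1"
        using that by auto
      then show ?thesis
        by simp
    qed
    ultimately have "(T \<subseteq> {0..<e} \<and> (\<forall>t\<in>T. (t + 1) mod e \<notin> T)) \<and> card T = i \<and> e - 1 \<notin> T
        \<longleftrightarrow> T \<subseteq> {0..<e - 1} \<and> card T = i \<and> (\<forall>t\<in>T. Suc t \<notin> T)" for T
      by (smt (verit) ball_cong)
    then show ?thesis
      by (simp only: M_def cycle_indep_def path_indep_def mem_Collect_eq)
  qed
  also have "card (path_indep (e - 1) i) = (e - i) choose i"
    using card_path_indep[of "e - 1" i] e by simp
  finally show ?thesis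
    by (simp add: M_def)
qed

text \<open>
  Both sides count the pairs of an independent i-set and a vertex outside of it: every such set
  misses e - i vertices, and every vertex is missed equally often. This is where the factor
  e / (e - i) in the number of independent sets of a cycle comes from.
\<close>

lemma card_cycle_indep:
  "(e - i) * card {T \<in> cycle_indep e. card T = i} = e * ((e - i) choose i)"
proof -
  define N where "N = {T \<in> cycle_indep e. card T = i}"
  have fin: "finite N"
    using finite_cycle_indep by (simp add: N_def)
  have "(e - i) * card N = (\<Sum>T\<in>N. card ({0..<e} - T))"
  proof -
    have "card ({0..<e} - T) = e - i" if "T \<in> N" for T
      using that finite_subset[of T "{0..<e}"]
      by (auto simp: N_def cycle_indep_def card_Diff_subset)
    then show ?thesis
      by simp
  qed
  also have "\<dots> = card (SIGMA T:N. {0..<e} - T)"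
    using fin by simp
  also have "\<dots> = card (SIGMA v:{0..<e}. {T \<in> N. v \<notin> T})"
    by (rule bij_betw_same_card[of prod.swap]) (auto simp: bij_betw_def inj_on_def image_iff)
  also have "\<dots> = (\<Sum>v\<in>{0..<e}. card {T \<in> N. v \<notin> T})"
    using fin by simp
  also have "\<dots> = (\<Sum>v\<in>{0..<e}. (e - i) choose i)"
  proof (rule sum.cong)
    fix v assume "v \<in> {0..<e}"
    then show "card {T \<in> N. v \<notin> T} = (e - i) choose i"
      using card_cycle_indep_missing[of v e i] by (simp add: N_def conj_ac)
  qed simp
  finally show ?thesis
    by (simp add: N_def)
qed

section \<open>Cyclic sieving for the two kinds of factors\<close>

lemma card_subsets_eq_poly_q_binomial:
  assumes "primitive_root_of_unity d \<omega>" "finite X"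
  shows "of_nat (card {B. B \<subseteq> X \<and> d * card B = b}) = poly (q_binomial (d * card X) b) \<omega>"
proof (cases "d dvd b")
  case True
  then obtain c where c: "b = d * c" ..
  have "d > 0"
    using assms by (simp add: primitive_root_of_unity_def)
  then have "{B. B \<subseteq> X \<and> d * card B = b} = {B. B \<subseteq> X \<and> card B = c}"
    by (simp add: c)
  then show ?thesis
    using n_subsets[OF assms(2), of c] by (simp add: c poly_q_binomial_dvd[OF assms(1)])
next
  case False
  then have "{B. B \<subseteq> X \<and> d * card B = b} = {}"
    by auto
  then show ?thesis
    by (simp only: card.empty of_nat_0 poly_q_binomial_not_dvd[OF assms(1) False])
qed

lemma card_cycle_indep_eq_poly_q_cycle_factor:
  assumes "primitive_root_of_unity d \<omega>" "e > 0"
  shows "of_nat (card {A \<in> cycle_indep e. d * card A = j}) = poly (q_cycle_factor (d * e) j) \<omega>"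
proof (cases "d dvd j")
  case True
  then obtain i where i: "j = d * i" ..
  have d: "d > 0"
    using assms by (simp add: primitive_root_of_unity_def)
  define N where "N = card {A \<in> cycle_indep e. card A = i}"
  have N: "{A \<in> cycle_indep e. d * card A = j} = {A \<in> cycle_indep e. card A = i}"
    using d by (simp add: i)
  show ?thesis
  proof (cases "2 * i \<le> e")
    case True
    then have "of_nat (e - i) * poly (q_cycle_factor (d * e) j) \<omega> = of_nat (e - i) * of_nat N"
      using poly_q_cycle_factor_dvd[OF assms True] card_cycle_indep[of e i]
      by (metis N_def i of_nat_mult)
    moreover have "e - i \<noteq> 0"
      using True assms(2) by simp
    ultimately have "poly (q_cycle_factor (d * e) j) \<omega> = of_nat N"
      by (metis mult_cancel_left of_nat_eq_0_iff)
    then show ?thesis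
      by (simp add: N N_def)
  next
    case False
    have "N = 0"
    proof (cases "i < e")
      case True
      then show ?thesis
        using False card_cycle_indep[of e i] by (simp add: N_def binomial_eq_0)
    next
      case i_ge: False
      have "card A \<noteq> i" if A: "A \<in> cycle_indep e" for A
      proof
        assume "card A = i"
        moreover have "A \<subseteq> {0..<e}"
          using A by (simp add: cycle_indep_def)
        ultimately have "A = {0..<e}"
          using i_ge by (intro card_subset_eq) (auto dest: card_mono[rotated])
        then have "0 \<in> A" "(0 + 1) mod e \<in> A"
          using assms(2) by auto
        then show False
          using A by (auto simp: cycle_indep_def)
      qed
      then have "{A \<in> cycle_indep e. card A = i} = {}"
        by blast
      then show ?thesis
        unfolding N_def by (simp only: card.empty)
    qed
    moreover have "\<not> 2 * j \<le> d * e"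
      using False d by (simp add: i mult.left_commute)
    ultimately show ?thesis
      by (simp add: N N_def q_cycle_factor_def)
  qed
next
  case False
  then have "{A \<in> cycle_indep e. d * card A = j} = {}"
    by auto
  then show ?thesis
    by (simp only: card.empty of_nat_0 poly_q_cycle_factor_not_dvd[OF assms False])
qed

text \<open>
  For the pairs of an independent set A of the e-cycle and a set B of vertices outside of A, the
  number of choices of B depends on A through its size only. This is why the polynomial is a sum
  of products.
\<close>

lemma card_cycle_indep_pairs:
  assumes "primitive_root_of_unity d \<omega>" "e > 0"
  shows "of_nat (card {(A, B). A \<in> cycle_indep e \<and> B \<subseteq> {0..<e} - A \<and> d * (card A + card B) = k})
    = poly (\<Sum>j=0..k. q_cycle_factor (d * e) j * q_binomial (d * e - j) (k - j)) \<omega>"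
proof -
  define Q where "Q A b = {B. B \<subseteq> {0..<e} - A \<and> d * card B = b}" for A b
  define N where "N j = {A \<in> cycle_indep e. d * card A = j}" for j
  have finN: "finite (N j)" for j
    using finite_cycle_indep by (simp add: N_def)
  have finQ: "finite (Q A b)" for A b
    by (rule finite_subset[of _ "Pow {0..<e}"]) (auto simp: Q_def)
  have "{(A, B). A \<in> cycle_indep e \<and> B \<subseteq> {0..<e} - A \<and> d * (card A + card B) = k}
      = (\<Union>j\<in>{0..k}. SIGMA A:N j. Q A (k - j))"
    by (auto simp: N_def Q_def algebra_simps)
  also have "card \<dots> = (\<Sum>j=0..k. card (SIGMA A:N j. Q A (k - j)))"
    by (intro card_UN_disjoint ballI finite_SigmaI finN finQ) (auto simp: N_def)
  also have "of_nat \<dots> = (\<Sum>j=0..k. poly (q_cycle_factor (d * e) j * q_binomial (d * e - j) (k - j)) \<omega>)"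
    unfolding of_nat_sum
  proof (rule sum.cong)
    fix j
    have "of_nat (card (Q A (k - j))) = poly (q_binomial (d * e - j) (k - j)) \<omega>"
      if "A \<in> N j" for A
    proof -
      have "A \<subseteq> {0..<e}" "d * card A = j"
        using that by (auto simp: N_def cycle_indep_def)
      then have "d * card ({0..<e} - A) = d * e - j"
        by (simp add: card_Diff_subset finite_subset[OF _ finite_atLeastLessThan] diff_mult_distrib2)
      then show ?thesis
        using card_subsets_eq_poly_q_binomial[OF assms(1), of "{0..<e} - A"] by (simp add: Q_def)
    qed
    then have "of_nat (card (SIGMA A:N j. Q A (k - j)))
        = of_nat (card (N j)) * poly (q_binomial (d * e - j) (k - j)) \<omega>"
      by (simp add: finN finQ)
    also have "of_nat (card (N j)) = poly (q_cycle_factor (d * e) j) \<omega>"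
      unfolding N_def by (rule card_cycle_indep_eq_poly_q_cycle_factor[OF assms])
    finally show "of_nat (card (SIGMA A:N j. Q A (k - j)))
        = poly (q_cycle_factor (d * e) j * q_binomial (d * e - j) (k - j)) \<omega>"
      by simp
  qed simp
  finally show ?thesis
    by (simp add: poly_sum)
qed

section \<open>Actions on the helm graph and on its independent sets\<close>

lemma group_actionI:
  assumes "group G"
    and "\<And>g. g \<in> carrier G \<Longrightarrow> f g \<in> extensional E"
    and "\<And>g x. g \<in> carrier G \<Longrightarrow> x \<in> E \<Longrightarrow> f g x \<in> E"
    and "\<And>g h x. g \<in> carrier G \<Longrightarrow> h \<in> carrier G \<Longrightarrow> x \<in> E \<Longrightarrow> f (g \<otimes>\<^bsub>G\<^esub> h) x = f g (f h x)"
    and "\<And>x. x \<in> E \<Longrightarrow> f \<one>\<^bsub>G\<^esub> x = x"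
  shows "group_action G E f"
proof -
  interpret group G by fact
  have bij: "f g \<in> Bij E" if g: "g \<in> carrier G" for g
  proof -
    have "f (inv\<^bsub>G\<^esub> g) (f g x) = x" "f g (f (inv\<^bsub>G\<^esub> g) x) = x" if "x \<in> E" for x
      using assms(4)[of "inv\<^bsub>G\<^esub> g" g x] assms(4)[of g "inv\<^bsub>G\<^esub> g" x] assms(5) g that by simp_all
    then have "bij_betw (f g) E E"
      using assms(3) g by (intro bij_betw_byWitness[where f' = "f (inv\<^bsub>G\<^esub> g)"]) auto
    then show ?thesis
      using assms(2) g by (simp add: Bij_def)
  qed
  have "f (g \<otimes>\<^bsub>G\<^esub> h) = compose E (f g) (f h)" if "g \<in> carrier G" "h \<in> carrier G" for g h
    using that assms(2,4) by (intro extensionalityI[of _ E]) (auto simp: compose_def)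
  then have "f \<in> hom G (BijGroup E)"
    using bij by (auto simp: hom_def BijGroup_def)
  then show ?thesis
    by (simp add: group_action_def group_hom_def group_hom_axioms_def group_BijGroup is_group)
qed

lemma group_action_one:
  assumes "group_action G E f" "x \<in> E"
  shows "f \<one>\<^bsub>G\<^esub> x = x"
  using group_action.id_eq_one[OF assms(1)] assms(2) by (metis restrict_apply')

lemma group_action_imp_group: "group_action G E f \<Longrightarrow> group G"
  by (simp add: group_action_def group_hom_def)

lemma group_action_pow:
  assumes "group_action C {0..<n} \<phi>" "c \<in> carrier C" "\<And>i. i < n \<Longrightarrow> \<phi> c i = (i + 1) mod n" "i < n"
  shows "\<phi> (c [^]\<^bsub>C\<^esub> (m :: nat)) i = (i + m) mod n"
  using assms(4)
proof (induction m arbitrary: i)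
  case 0
  then show ?case
    using group_action_one[OF assms(1)] by simp
next
  case (Suc m)
  interpret group C
    by (rule group_action_imp_group[OF assms(1)])
  have "\<phi> (c [^]\<^bsub>C\<^esub> Suc m) i = \<phi> (c [^]\<^bsub>C\<^esub> m) (\<phi> c i)"
    using group_action.composition_rule[OF assms(1), of i "c [^]\<^bsub>C\<^esub> m" c] Suc(2) assms(2) by simp
  also have "\<dots> = ((i + 1) mod n + m) mod n"
    using Suc assms(3) by simp
  finally show ?case
    by (simp add: mod_simps)
qed

lemma pverts_helm_graph:
  "pverts (helm_graph n) = insert None (Some ` (Orig ` {0..<n} \<union> Copy ` {0..<n}))"
  by (simp add: helm_graph_def whiskering_def cycle_graph_def)

lemma pair_in_map_prod_image_iff:
  assumes "inj f"
  shows "(f a, f b) \<in> map_prod f f ` Z \<longleftrightarrow> (a, b) \<in> Z"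
  using inj_image_mem_iff[OF prod.inj_map[OF assms assms], of "(a, b)" Z] by simp

lemma parcs_helm_graph [simp]:
  "(Some (Orig i), Some (Orig j)) \<in> parcs (helm_graph n) \<longleftrightarrow> (i, j) \<in> parcs (cycle_graph n)"
  "(Some (Orig i), Some (Copy j)) \<in> parcs (helm_graph n) \<longleftrightarrow> i = j \<and> i < n"
  "(Some (Copy i), Some (Orig j)) \<in> parcs (helm_graph n) \<longleftrightarrow> i = j \<and> i < n"
  "(Some (Copy i), Some (Copy j)) \<notin> parcs (helm_graph n)"
  "(None, Some (Orig i)) \<in> parcs (helm_graph n) \<longleftrightarrow> i < n"
  "(Some (Orig i), None) \<in> parcs (helm_graph n) \<longleftrightarrow> i < n"
  "(None, Some (Copy i)) \<notin> parcs (helm_graph n)"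
  "(Some (Copy i), None) \<notin> parcs (helm_graph n)"
  "(None, None) \<notin> parcs (helm_graph n)"
  by (auto simp: helm_graph_def whiskering_def cycle_graph_def pair_in_map_prod_image_iff inj_def)

lemma graph_action_helm:
  assumes "graph_action C (cycle_graph n) \<phi>"
  shows "graph_action C (helm_graph n) (helm_action n \<phi>)"
proof -
  have act: "group_action C {0..<n} \<phi>"
    and arcs: "\<And>g u v. g \<in> carrier C \<Longrightarrow> u < n \<Longrightarrow> v < n
      \<Longrightarrow> (\<phi> g u, \<phi> g v) \<in> parcs (cycle_graph n) \<longleftrightarrow> (u, v) \<in> parcs (cycle_graph n)"
    using assms by (auto simp: graph_action_def cycle_graph_def)
  interpret group C
    by (rule group_action_imp_group[OF act])
  have img: "\<phi> g i < n" if "g \<in> carrier C" "i < n" for g i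
    using group_action.element_image[OF act that(1), of i] that(2) by simp
  have inj: "\<phi> g i = \<phi> g j \<longleftrightarrow> i = j" if "g \<in> carrier C" "i < n" "j < n" for g i j
    using inj_on_eq_iff[OF group_action.inj_prop[OF act that(1)], of i j] that(2,3) by simp
  have V: "helm_action n \<phi> g x \<in> pverts (helm_graph n)"
    if "g \<in> carrier C" "x \<in> pverts (helm_graph n)" for g x
    using that img by (auto simp: helm_action_def pverts_helm_graph)
  have "group_action C (pverts (helm_graph n)) (helm_action n \<phi>)"
  proof (rule group_actionI[OF is_group])
    fix g h x assume *: "g \<in> carrier C" "h \<in> carrier C" "x \<in> pverts (helm_graph n)"
    then have "\<phi> (g \<otimes>\<^bsub>C\<^esub> h) i = \<phi> g (\<phi> h i)" if "i < n" for i
      using group_action.composition_rule[OF act, of i g h] that by simp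
    then show "helm_action n \<phi> (g \<otimes>\<^bsub>C\<^esub> h) x = helm_action n \<phi> g (helm_action n \<phi> h x)"
      using * img by (auto simp: helm_action_def pverts_helm_graph)
  next
    fix x assume "x \<in> pverts (helm_graph n)"
    then show "helm_action n \<phi> \<one>\<^bsub>C\<^esub> x = x"
      using group_action_one[OF act] by (auto simp: helm_action_def pverts_helm_graph)
  qed (use V in \<open>auto simp: helm_action_def\<close>)
  moreover have "(helm_action n \<phi> g u, helm_action n \<phi> g v) \<in> parcs (helm_graph n)
      \<longleftrightarrow> (u, v) \<in> parcs (helm_graph n)"
    if "g \<in> carrier C" "u \<in> pverts (helm_graph n)" "v \<in> pverts (helm_graph n)" for g u v
    using that img arcs inj by (auto simp: helm_action_def pverts_helm_graph)
  ultimately show ?thesis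
    by (simp add: graph_action_def)
qed

lemma group_action_indep_sets:
  assumes "graph_action C G \<phi>"
  shows "group_action C (indep_sets k G) (set_action (indep_sets k G) \<phi>)"
proof -
  have act: "group_action C (pverts G) \<phi>"
    and arcs: "\<And>g u v. g \<in> carrier C \<Longrightarrow> u \<in> pverts G \<Longrightarrow> v \<in> pverts G
      \<Longrightarrow> (\<phi> g u, \<phi> g v) \<in> parcs G \<longleftrightarrow> (u, v) \<in> parcs G"
    using assms by (auto simp: graph_action_def)
  interpret group C
    by (rule group_action_imp_group[OF act])
  have V: "\<phi> g ` S \<in> indep_sets k G" if g: "g \<in> carrier C" and S: "S \<in> indep_sets k G" for g S
  proof -
    have sub: "S \<subseteq> pverts G" "finite S" "card S = k" "\<And>u v. u \<in> S \<Longrightarrow> v \<in> S \<Longrightarrow> (u, v) \<notin> parcs G"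
      using S by (auto simp: indep_sets_def)
    have "\<phi> g ` S \<subseteq> pverts G"
      using group_action.element_image[OF act g] sub(1) by blast
    moreover have "card (\<phi> g ` S) = k"
      using card_image[OF inj_on_subset[OF group_action.inj_prop[OF act g] sub(1)]] sub(3) by simp
    moreover have "(\<phi> g u, \<phi> g v) \<notin> parcs G" if "u \<in> S" "v \<in> S" for u v
      using arcs[OF g] sub(1) sub(4)[OF that] that by blast
    ultimately show ?thesis
      using sub(2) by (auto simp: indep_sets_def)
  qed
  show ?thesis
  proof (rule group_actionI[OF is_group])
    fix g h S assume *: "g \<in> carrier C" "h \<in> carrier C" "S \<in> indep_sets k G"
    then have "S \<subseteq> pverts G"
      by (auto simp: indep_sets_def)
    then have "\<phi> (g \<otimes>\<^bsub>C\<^esub> h) ` S = \<phi> g ` \<phi> h ` S"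
      using group_action.composition_rule[OF act _ *(1,2)] by (force simp: image_image)
    then show "set_action (indep_sets k G) \<phi> (g \<otimes>\<^bsub>C\<^esub> h) S =
        set_action (indep_sets k G) \<phi> g (set_action (indep_sets k G) \<phi> h S)"
      using * V by (simp add: set_action_def)
  next
    fix S assume S: "S \<in> indep_sets k G"
    then have "\<phi> \<one>\<^bsub>C\<^esub> ` S = S"
      using group_action_one[OF act] by (force simp: indep_sets_def)
    then show "set_action (indep_sets k G) \<phi> \<one>\<^bsub>C\<^esub> S = S"
      using S by (simp add: set_action_def)
  qed (use V in \<open>auto simp: set_action_def\<close>)
qed

section \<open>Sets invariant under a rotation\<close>

definition periodic_ext :: "nat \<Rightarrow> nat \<Rightarrow> nat set \<Rightarrow> nat set" where
  "periodic_ext n e T = {i \<in> {0..<n}. i mod e \<in> T}"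

lemma periodic_ext_Int:
  assumes "e dvd n" "n > 0" "T \<subseteq> {0..<e}"
  shows "periodic_ext n e T \<inter> {0..<e} = T"
  using assms dvd_imp_le[of e n] by (auto simp: periodic_ext_def)

lemma periodic_ext_eq_iff:
  assumes "e dvd n" "n > 0" "T \<subseteq> {0..<e}" "U \<subseteq> {0..<e}"
  shows "periodic_ext n e T = periodic_ext n e U \<longleftrightarrow> T = U"
  using assms periodic_ext_Int by metis

lemma card_periodic_ext:
  assumes "e > 0" "T \<subseteq> {0..<e}"
  shows "card (periodic_ext (d * e) e T) = d * card T"
proof -
  have "bij_betw (\<lambda>i. (i div e, i mod e)) (periodic_ext (d * e) e T) ({0..<d} \<times> T)"
  proof (rule bij_betw_byWitness[where f' = "\<lambda>(q, r). q * e + r"])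
    have "q * e + r < d * e" if "q < d" "r \<in> T" for q r
    proof -
      have "q * e + r < Suc q * e"
        using that assms by auto
      also have "\<dots> \<le> d * e"
        using that(1) by (intro mult_le_mono1) simp
      finally show ?thesis .
    qed
    then show "(\<lambda>(q, r). q * e + r) ` ({0..<d} \<times> T) \<subseteq> periodic_ext (d * e) e T"
      using assms by (auto simp: periodic_ext_def subset_iff)
    show "(\<lambda>i. (i div e, i mod e)) ` periodic_ext (d * e) e T \<subseteq> {0..<d} \<times> T"
      by (auto simp: periodic_ext_def less_mult_imp_div_less)
  qed (use assms in \<open>auto simp: periodic_ext_def subset_iff\<close>)
  then show ?thesis
    by (simp add: bij_betw_same_card card_cartesian_product)
qed

text \<open>Adjacency in the n-cycle projects to adjacency in the e-cycle, because e divides n.\<close>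

lemma periodic_ext_in_cycle_indep_iff:
  assumes "e dvd n" "n > 0" "T \<subseteq> {0..<e}"
  shows "periodic_ext n e T \<in> cycle_indep n \<longleftrightarrow> T \<in> cycle_indep e"
proof -
  have succ: "(i + 1) mod n \<in> periodic_ext n e T \<longleftrightarrow> (i mod e + 1) mod e \<in> T" for i
    using assms by (simp add: periodic_ext_def mod_mod_cancel mod_simps)
  have mem: "t \<in> periodic_ext n e T" "t mod e = t" if "t \<in> T" for t
    using assms that dvd_imp_le[of e n] by (auto simp: periodic_ext_def)
  show ?thesis
  proof
    assume "periodic_ext n e T \<in> cycle_indep n"
    then have "(t + 1) mod e \<notin> T" if "t \<in> T" for t
      using succ[of t] mem[OF that] by (auto simp: cycle_indep_def)
    then show "T \<in> cycle_indep e"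
      using assms(3) by (simp add: cycle_indep_def)
  next
    assume T: "T \<in> cycle_indep e"
    have "(i + 1) mod n \<notin> periodic_ext n e T" if "i \<in> periodic_ext n e T" for i
    proof -
      have "i mod e \<in> T"
        using that by (simp add: periodic_ext_def)
      then show ?thesis
        using T succ[of i] by (simp add: cycle_indep_def)
    qed
    moreover have "periodic_ext n e T \<subseteq> {0..<n}"
      by (auto simp: periodic_ext_def)
    ultimately show "periodic_ext n e T \<in> cycle_indep n"
      by (simp add: cycle_indep_def)
  qed
qed

lemma periodic_ext_Int_eq_empty_iff:
  assumes "e dvd n" "n > 0" "T \<subseteq> {0..<e}" "U \<subseteq> {0..<e}"
  shows "periodic_ext n e T \<inter> periodic_ext n e U = {} \<longleftrightarrow> T \<inter> U = {}"
proof -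
  have "periodic_ext n e T \<inter> periodic_ext n e U = periodic_ext n e (T \<inter> U)"
    by (auto simp: periodic_ext_def)
  moreover have "periodic_ext n e {} = {}"
    by (simp add: periodic_ext_def)
  ultimately show ?thesis
    using periodic_ext_eq_iff[OF assms(1,2), of "T \<inter> U" "{}"] assms(3) by (metis empty_subsetI le_infI1)
qed

text \<open>
  By Bezout, the rotations by m and by gcd m n generate the same group, so that a set invariant
  under the first contains all vertices that are congruent modulo gcd m n to one of its elements.
\<close>

lemma rotation_fixed_iff_periodic:
  assumes "n > 0" "A \<subseteq> {0..<n}" "inj_on f {0..<n}" "\<And>i. i < n \<Longrightarrow> f i = (i + m) mod n"
    and e: "e = gcd m n"
  shows "f ` A = A \<longleftrightarrow> (\<exists>T\<subseteq>{0..<e}. A = periodic_ext n e T)"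
proof
  assume fix_A: "f ` A = A"
  have epos: "e > 0" and edvd: "e dvd n"
    using assms by auto
  have closed: "(i + a * m) mod n \<in> A" if "i \<in> A" for i a
  proof (induction a)
    case 0
    then show ?case using that assms(2) by auto
  next
    case (Suc a)
    then have "f ((i + a * m) mod n) \<in> A"
      using fix_A by blast
    then show ?case
      using assms(1,4) by (simp add: mod_simps algebra_simps)
  qed
  have cong: "j \<in> A" if i: "i \<in> A" and j: "j < n" and ij: "i mod e = j mod e" for i j
  proof -
    obtain a where a: "[m * a = e] (mod n)"
      using cong_solve_nat[of m n] e by blast
    have "i < n"
      using i assms(2) by auto
    \<comment> \<open>The summand n makes the difference of j and i a natural number.\<close>
    have "[i = j + n] (mod e)"
      using ij edvd by (metis cong_def cong_add_lcancel_0_nat cong_0_iff cong_trans cong_sym)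
    then have "e dvd j + n - i"
      using \<open>i < n\<close> by (metis cong_altdef_nat cong_sym trans_less_add2 less_imp_le)
    then obtain s where s: "j + n - i = e * s" ..
    have "[i + (a * s) * m = i + e * s] (mod n)"
      using cong_mult[OF a cong_refl[of s]] by (intro cong_add) (auto simp: mult_ac)
    then have "(i + (a * s) * m) mod n = (i + e * s) mod n"
      by (simp add: cong_def)
    also have "i + e * s = j + n"
      using s \<open>i < n\<close> by linarith
    finally show ?thesis
      using closed[OF i, of "a * s"] j by simp
  qed
  have "i \<in> A \<longleftrightarrow> i mod e \<in> A" if "i < n" for i
  proof -
    have "i mod e < n"
      using that by (meson le_less_trans mod_less_eq_dividend)
    then show ?thesis
      using cong[of i "i mod e"] cong[of "i mod e" i] that by auto
  qed
  then have "A = periodic_ext n e (A \<inter> {0..<e})"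
    using assms(2) epos by (auto simp: periodic_ext_def subset_iff)
  then show "\<exists>T\<subseteq>{0..<e}. A = periodic_ext n e T"
    by blast
next
  assume "\<exists>T\<subseteq>{0..<e}. A = periodic_ext n e T"
  then obtain T where T: "A = periodic_ext n e T" by blast
  have "((i + m) mod n) mod e = i mod e" for i
    by (metis e dvd_def gcd_dvd1 gcd_dvd2 mod_mod_cancel mod_mult_self2)
  then have "f ` A \<subseteq> A"
    using assms(1,4) by (auto simp: T periodic_ext_def)
  moreover have "finite A" "inj_on f A"
    using assms(2,3) by (auto intro: finite_subset inj_on_subset)
  ultimately show "f ` A = A"
    by (intro endo_inj_surj)
qed

section \<open>Invariant independent sets of the helm graph\<close>

definition helm_set :: "nat set \<Rightarrow> nat set \<Rightarrow> nat whisker_vertex option set" where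
  "helm_set A B = Some ` (Orig ` A \<union> Copy ` B)"

lemma Some_in_helm_set:
  "Some (Orig i) \<in> helm_set A B \<longleftrightarrow> i \<in> A"
  "Some (Copy i) \<in> helm_set A B \<longleftrightarrow> i \<in> B"
  by (auto simp: helm_set_def)

lemma ball_helm_set:
  "(\<forall>x\<in>helm_set A B. P x) \<longleftrightarrow> (\<forall>i\<in>A. P (Some (Orig i))) \<and> (\<forall>i\<in>B. P (Some (Copy i)))"
  by (auto simp: helm_set_def)

lemma helm_set_eq_iff: "helm_set A B = helm_set A' B' \<longleftrightarrow> A = A' \<and> B = B'"
proof
  assume eq: "helm_set A B = helm_set A' B'"
  have "i \<in> A \<longleftrightarrow> i \<in> A'" "i \<in> B \<longleftrightarrow> i \<in> B'" for i
    using eq Some_in_helm_set by metis+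
  then show "A = A' \<and> B = B'"
    by blast
qed simp

lemma None_notin_helm_set: "None \<notin> helm_set A B"
  by (auto simp: helm_set_def)

lemma insert_None_helm_set_eq_iff:
  "insert None (helm_set A B) = insert None (helm_set A' B') \<longleftrightarrow> A = A' \<and> B = B'"
  by (simp add: insert_ident None_notin_helm_set helm_set_eq_iff)

lemma card_helm_set:
  assumes "finite A" "finite B"
  shows "card (helm_set A B) = card A + card B"
proof -
  have "card (Orig ` A \<union> Copy ` B) = card (Orig ` A) + card (Copy ` B)"
    using assms by (intro card_Un_disjoint) auto
  then show ?thesis
    by (simp add: helm_set_def card_image inj_on_def)
qed

lemma helm_set_cases:
  assumes "S \<subseteq> pverts (helm_graph n)"
  obtains A B where "A \<subseteq> {0..<n}" "B \<subseteq> {0..<n}" "S = helm_set A B \<or> S = insert None (helm_set A B)"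
proof -
  define A where "A = {i. Some (Orig i) \<in> S}"
  define B where "B = {i. Some (Copy i) \<in> S}"
  have "S - {None} = helm_set A B"
  proof (rule Set.set_eqI)
    fix x
    show "x \<in> S - {None} \<longleftrightarrow> x \<in> helm_set A B"
    proof (cases x)
      case (Some y)
      then show ?thesis
        by (cases y) (simp_all add: A_def B_def Some_in_helm_set)
    qed (simp add: None_notin_helm_set)
  qed
  then have "S = helm_set A B \<or> S = insert None (helm_set A B)"
    by blast
  moreover have "A \<subseteq> {0..<n}" "B \<subseteq> {0..<n}"
    using assms by (auto simp: A_def B_def pverts_helm_graph)
  ultimately show thesis
    using that by blast
qed

lemma helm_set_in_indep_sets_iff:
  assumes "A \<subseteq> {0..<n}" "B \<subseteq> {0..<n}"
  shows "helm_set A B \<in> indep_sets k (helm_graph n)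
    \<longleftrightarrow> A \<in> cycle_indep n \<and> A \<inter> B = {} \<and> card A + card B = k"
proof -
  have fin: "finite A" "finite B"
    using assms by (auto intro: finite_subset)
  have "(\<forall>u\<in>helm_set A B. \<forall>v\<in>helm_set A B. (u, v) \<notin> parcs (helm_graph n)) \<longleftrightarrow>
      (\<forall>i\<in>A. \<forall>j\<in>A. (i, j) \<notin> parcs (cycle_graph n)) \<and> A \<inter> B = {}"
    using assms by (auto simp: ball_helm_set)
  also have "(\<forall>i\<in>A. \<forall>j\<in>A. (i, j) \<notin> parcs (cycle_graph n)) \<longleftrightarrow> A \<in> cycle_indep n"
  proof -
    have "(i, j) \<in> parcs (cycle_graph n) \<longleftrightarrow> j = (i + 1) mod n \<or> i = (j + 1) mod n"
      if "i \<in> A" "j \<in> A" for i j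
      using that assms(1) by (auto simp: cycle_graph_def)
    then have "(\<forall>i\<in>A. \<forall>j\<in>A. (i, j) \<notin> parcs (cycle_graph n)) \<longleftrightarrow> (\<forall>i\<in>A. (i + 1) mod n \<notin> A)"
      by metis
    then show ?thesis
      using assms(1) by (simp add: cycle_indep_def)
  qed
  finally show ?thesis
    using assms fin card_helm_set[OF fin]
    by (auto simp: indep_sets_def helm_set_def pverts_helm_graph)
qed

lemma insert_None_helm_set_in_indep_sets_iff:
  assumes "A \<subseteq> {0..<n}" "B \<subseteq> {0..<n}"
  shows "insert None (helm_set A B) \<in> indep_sets k (helm_graph n) \<longleftrightarrow> A = {} \<and> Suc (card B) = k"
proof -
  have fin: "finite A" "finite B"
    using assms by (auto intro: finite_subset)
  have "(\<forall>u\<in>insert None (helm_set A B). \<forall>v\<in>insert None (helm_set A B). (u, v) \<notin> parcs (helm_graph n))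
      \<longleftrightarrow> A = {}"
    using assms by (auto simp: ball_helm_set)
  moreover have "finite (helm_set A B)"
    using fin by (simp add: helm_set_def)
  ultimately show ?thesis
    using assms fin card_helm_set[OF fin] None_notin_helm_set[of A B]
    by (auto simp: indep_sets_def pverts_helm_graph) (auto simp: helm_set_def)
qed

lemma helm_action_image:
  assumes "A \<subseteq> {0..<n}" "B \<subseteq> {0..<n}"
  shows "helm_action n \<phi> g ` helm_set A B = helm_set (\<phi> g ` A) (\<phi> g ` B)"
    and "helm_action n \<phi> g ` insert None (helm_set A B) = insert None (helm_set (\<phi> g ` A) (\<phi> g ` B))"
proof -
  have "helm_action n \<phi> g (Some (Orig i)) = Some (Orig (\<phi> g i))"
    "helm_action n \<phi> g (Some (Copy i)) = Some (Copy (\<phi> g i))" if "i < n" for i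
    using that by (simp_all add: helm_action_def pverts_helm_graph)
  then show 1: "helm_action n \<phi> g ` helm_set A B = helm_set (\<phi> g ` A) (\<phi> g ` B)"
    using assms unfolding helm_set_def image_Un image_image
    by (intro arg_cong2[where f = "(\<union>)"] image_cong) auto
  have "helm_action n \<phi> g None = None"
    by (simp add: helm_action_def pverts_helm_graph)
  then show "helm_action n \<phi> g ` insert None (helm_set A B) = insert None (helm_set (\<phi> g ` A) (\<phi> g ` B))"
    by (simp add: 1)
qed

text \<open>
  An invariant independent set of the helm graph is the periodic extension of its restriction to
  one period: a set B of whiskers together with either the central vertex or an independent set A
  of the e-cycle that avoids B.
\<close>

lemma card_invariants_indep_sets_helm:
  assumes "n = d * e" "n > 0" "k \<ge> 1" "inj_on (\<phi> g) {0..<n}"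
    and rot: "\<And>i. i < n \<Longrightarrow> \<phi> g i = (i + m) mod n" and e: "e = gcd m n"
  shows "card (invariants (indep_sets k (helm_graph n))
      (set_action (indep_sets k (helm_graph n)) (helm_action n \<phi>)) g)
    = card {B. B \<subseteq> {0..<e} \<and> d * card B = k - 1}
      + card {(A, B). A \<in> cycle_indep e \<and> B \<subseteq> {0..<e} - A \<and> d * (card A + card B) = k}"
proof -
  define I where "I = invariants (indep_sets k (helm_graph n))
      (set_action (indep_sets k (helm_graph n)) (helm_action n \<phi>)) g"
  define Q where "Q = {B. B \<subseteq> {0..<e} \<and> d * card B = k - 1}"
  define P where "P = {(A, B). A \<in> cycle_indep e \<and> B \<subseteq> {0..<e} - A \<and> d * (card A + card B) = k}"
  define X where "X = periodic_ext n e"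
  define F where "F = (\<lambda>B. insert None (helm_set {} (X B)))"
  define H where "H = (\<lambda>(A, B). helm_set (X A) (X B))"
  have epos: "e > 0" and edvd: "e dvd n"
    using assms(1,2) by auto
  have X: "X T \<subseteq> {0..<n}" for T
    by (auto simp: X_def periodic_ext_def)
  have cardX: "card (X T) = d * card T" if "T \<subseteq> {0..<e}" for T
    using card_periodic_ext[OF epos that] assms(1) by (simp add: X_def)
  have X_eq: "X T = X U \<longleftrightarrow> T = U" if "T \<subseteq> {0..<e}" "U \<subseteq> {0..<e}" for T U
    using periodic_ext_eq_iff[OF edvd assms(2) that] by (simp add: X_def)
  have X_Int: "X T \<inter> X U = {} \<longleftrightarrow> T \<inter> U = {}" if "T \<subseteq> {0..<e}" "U \<subseteq> {0..<e}" for T U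
    using periodic_ext_Int_eq_empty_iff[OF edvd assms(2) that] by (simp add: X_def)
  have X_indep: "X T \<in> cycle_indep n \<longleftrightarrow> T \<in> cycle_indep e" if "T \<subseteq> {0..<e}" for T
    using periodic_ext_in_cycle_indep_iff[OF edvd assms(2) that] by (simp add: X_def)
  have fix_iff: "\<phi> g ` A = A \<longleftrightarrow> (\<exists>T\<subseteq>{0..<e}. A = X T)" if "A \<subseteq> {0..<n}" for A
    using rotation_fixed_iff_periodic[OF assms(2) that assms(4) rot e] by (simp add: X_def)
  have fixX: "\<phi> g ` X T = X T" if "T \<subseteq> {0..<e}" for T
    using fix_iff[OF X] that by blast
  have I_iff: "S \<in> I \<longleftrightarrow> S \<in> indep_sets k (helm_graph n) \<and> helm_action n \<phi> g ` S = S" for S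
    by (auto simp: I_def invariants_def set_action_def)
  have "I = F ` Q \<union> H ` P"
  proof (intro equalityI subsetI)
    fix S assume "S \<in> I"
    then have S: "S \<in> indep_sets k (helm_graph n)" "helm_action n \<phi> g ` S = S"
      by (simp_all add: I_iff)
    then have "S \<subseteq> pverts (helm_graph n)"
      by (simp add: indep_sets_def)
    then obtain A B where AB: "A \<subseteq> {0..<n}" "B \<subseteq> {0..<n}"
        and S_cases: "S = helm_set A B \<or> S = insert None (helm_set A B)"
      by (rule helm_set_cases)
    have "\<phi> g ` A = A" "\<phi> g ` B = B"
      using S_cases S(2) helm_action_image[OF AB, of \<phi> g] helm_set_eq_iff
        insert_None_helm_set_eq_iff by metis+
    then obtain T U where TU: "T \<subseteq> {0..<e}" "U \<subseteq> {0..<e}" "A = X T" "B = X U"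
      using fix_iff[OF AB(1)] fix_iff[OF AB(2)] by blast
    show "S \<in> F ` Q \<union> H ` P"
      using S_cases
    proof
      assume S_eq: "S = helm_set A B"
      then have "T \<in> cycle_indep e" "T \<inter> U = {}" "d * card T + d * card U = k"
        using S(1) helm_set_in_indep_sets_iff[OF AB] TU X_indep X_Int cardX by auto
      then have "(T, U) \<in> P"
        using TU by (auto simp: P_def algebra_simps)
      then show ?thesis
        using S_eq TU by (force simp: H_def)
    next
      assume S_eq: "S = insert None (helm_set A B)"
      then have "A = {}" "Suc (d * card U) = k"
        using S(1) insert_None_helm_set_in_indep_sets_iff[OF AB] TU cardX by auto
      then have "U \<in> Q"
        using TU by (auto simp: Q_def)
      then show ?thesis
        using S_eq TU \<open>A = {}\<close> by (auto simp: F_def)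
    qed
  next
    fix S assume "S \<in> F ` Q \<union> H ` P"
    then show "S \<in> I"
    proof
      assume "S \<in> F ` Q"
      then obtain B where B: "B \<subseteq> {0..<e}" "d * card B = k - 1" "S = insert None (helm_set {} (X B))"
        by (auto simp: Q_def F_def)
      then show ?thesis
        using assms(3) cardX insert_None_helm_set_in_indep_sets_iff[of "{}" n "X B" k] X fixX
          helm_action_image(2)[of "{}" n "X B" \<phi> g] by (simp add: I_iff)
    next
      assume "S \<in> H ` P"
      then obtain A B where AB: "A \<in> cycle_indep e" "B \<subseteq> {0..<e} - A" "d * (card A + card B) = k"
          and S: "S = helm_set (X A) (X B)"
        by (auto simp: P_def H_def)
      moreover have "A \<subseteq> {0..<e}" "B \<subseteq> {0..<e}"
        using AB by (auto simp: cycle_indep_def)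
      moreover have "A \<inter> B = {}"
        using AB by auto
      ultimately show ?thesis
        using cardX helm_set_in_indep_sets_iff[OF X X, of A B k] X_indep X_Int
          helm_action_image(1)[OF X X, of \<phi> g A B] fixX by (simp add: I_iff algebra_simps)
    qed
  qed
  moreover have "inj_on F Q"
    by (intro inj_onI) (auto simp: F_def Q_def insert_None_helm_set_eq_iff X_eq)
  moreover have "A \<subseteq> {0..<e} \<and> B \<subseteq> {0..<e}" if "(A, B) \<in> P" for A B
    using that by (auto simp: P_def cycle_indep_def)
  then have "inj_on H P"
    by (intro inj_onI) (auto simp: H_def helm_set_eq_iff X_eq)
  moreover have "F ` Q \<inter> H ` P = {}"
    using None_notin_helm_set by (auto simp: F_def H_def)
  moreover have "finite Q"
    by (rule finite_subset[of _ "Pow {0..<e}"]) (auto simp: Q_def)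
  moreover have "finite P"
    by (rule finite_subset[of _ "Pow {0..<e} \<times> Pow {0..<e}"]) (auto simp: P_def cycle_indep_def)
  ultimately have "card I = card Q + card P"
    by (simp add: card_Un_disjoint card_image)
  then show ?thesis
    by (simp add: I_def P_def Q_def)
qed

section \<open>Cyclic sieving for the helm graph\<close>

theorem proposition14:
  fixes n k :: nat
    and C :: "('g, 'm) monoid_scheme"
    and \<phi> :: "'g \<Rightarrow> nat \<Rightarrow> nat"
  assumes "n \<ge> 3" and "k \<ge> 1"
    and "group C" and "cyclic_group C" and "Coset.order C = n"
    and "rotation_action C n \<phi>"
  shows "graph_action C (helm_graph n) (helm_action n \<phi>) \<and>
    exhibits_CSP (indep_sets k (helm_graph n)) C
      (set_action (indep_sets k (helm_graph n)) (helm_action n \<phi>))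
      (q_binomial n (k - 1) + (\<Sum>j=0..k. q_cycle_factor n j * q_binomial (n - j) (k - j)))"
proof -
  interpret group C by fact
  have cyc: "graph_action C (cycle_graph n) \<phi>"
    using assms(6) by (simp add: rotation_action_def)
  then have act: "group_action C {0..<n} \<phi>"
    by (simp add: graph_action_def cycle_graph_def)
  obtain c where c: "c \<in> carrier C" "subgroup_generated C {c} = C" "\<And>i. i < n \<Longrightarrow> \<phi> c i = (i + 1) mod n"
    using assms(6) by (auto simp: rotation_action_def)
  have helm: "graph_action C (helm_graph n) (helm_action n \<phi>)"
    by (rule graph_action_helm[OF cyc])
  have fin: "finite (carrier C)"
    using assms(1,5) by (intro card_ge_0_finite) (simp add: Coset.order_def)
  have "carrier C = generate C (carrier C \<inter> {c})"
    using carrier_subgroup_generated[of C "{c}"] unfolding c(2) .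
  also have "carrier C \<inter> {c} = {c}"
    using c(1) by simp
  finally have gen: "carrier C = {c [^]\<^bsub>C\<^esub> m | m. m \<in> (UNIV :: nat set)}"
    using generate_pow_on_finite_carrier[OF fin c(1)] by simp
  have ord_c: "ord c = n"
    using cyclic_order_is_ord[OF c(1)] c(2) assms(5) by simp
  have "of_nat (card (invariants (indep_sets k (helm_graph n))
        (set_action (indep_sets k (helm_graph n)) (helm_action n \<phi>)) g))
      = poly (q_binomial n (k - 1) + (\<Sum>j=0..k. q_cycle_factor n j * q_binomial (n - j) (k - j))) \<omega>"
    if g: "g \<in> carrier C" and \<omega>: "primitive_root_of_unity (ord g) \<omega>" for g \<omega>
  proof -
    obtain m :: nat where m: "g = c [^]\<^bsub>C\<^esub> m"
      using g gen by auto
    define e where "e = gcd m n"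
    have epos: "e > 0"
      using assms(1) by (simp add: e_def)
    have "ord g = n div e"
      using ord_pow_gen[OF c(1), of m] ord_c assms(1) by (simp add: m e_def gcd.commute)
    then have n: "n = ord g * e"
      by (simp add: e_def)
    have inj: "inj_on (\<phi> g) {0..<n}"
      by (rule group_action.inj_prop[OF act g])
    have rot: "\<phi> g i = (i + m) mod n" if "i < n" for i
      unfolding m by (rule group_action_pow[OF act c(1) c(3) that])
    have "of_nat (card {B. B \<subseteq> {0..<e} \<and> ord g * card B = k - 1}) = poly (q_binomial n (k - 1)) \<omega>"
      using card_subsets_eq_poly_q_binomial[OF \<omega>, of "{0..<e}"] n by simp
    moreover have "of_nat (card {(A, B). A \<in> cycle_indep e \<and> B \<subseteq> {0..<e} - A
          \<and> ord g * (card A + card B) = k})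
        = poly (\<Sum>j=0..k. q_cycle_factor n j * q_binomial (n - j) (k - j)) \<omega>"
      using card_cycle_indep_pairs[OF \<omega> epos, of k] n by simp
    moreover have "n > 0"
      using assms(1) by simp
    note card_invariants_indep_sets_helm[where \<phi> = \<phi> and g = g and m = m,
        OF n this assms(2) inj rot e_def]
    ultimately show ?thesis
      by (simp only: of_nat_add poly_add)
  qed
  moreover have "finite (indep_sets k (helm_graph n))"
    by (rule finite_subset[of _ "Pow (pverts (helm_graph n))"])
      (auto simp: indep_sets_def pverts_helm_graph)
  ultimately show ?thesis
    unfolding exhibits_CSP_def
    using helm group_action_indep_sets[OF helm] assms(3,4) fin by blast
qed

end
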